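(* Let $L_1,L_1',\dots,L_r,L_r'$ be linear forms on $V=\mathbb F_2^N$, with coefficient vectors $u_i,v_i$, i.e. $L_i(x)=u_i^{\mathsf T}x$ and $L_i'(x)=v_i^{\mathsf T}x$. Let $Q_i=L_iL_i'$. (i) If $x\in V$ is such that exactly one of $Q_1(x),\dots,Q_r(x)$ equals $1$, then $1+\sum_{i=1}^r L_i(x)L_i'(x)=0$. (ii) If the $2r$ forms are linearly independent, then the kernel of the polar form $B_R=\sum_{i=1}^r(u_iv_i^{\mathsf T}+v_iu_i^{\mathsf T})$ of $1+\sum_iL_iL_i'$ is $$\ker B_R=\bigcap_{i=1}^r\bigl(\ker L_i\cap\ker L_i'\bigr),$$ so every product $L_iL_i'$ vanishes identically on $\ker B_R$.
   Context: In the signature scheme under study (HFE with $LL'$ perturbations) the signing distribution accepts only signatures $x$ for which exactly one $Q_i(x)$ equals $1$. The polar form of a quadratic polynomial $f$ over $\mathbb F_2$ is the bilinear form $(x,y)\mapsto f(x+y)+f(x)+f(y)+f(0)$, identified with its matrix. *)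

theory Defs
  imports "HOL-Analysis.Analysis" "HOL-Library.Z2"
begin

text \<open>The field with two elements is the type \<^typ>\<open>bit\<close>, and the space of dimension \<open>N\<close>
  over it is \<^typ>\<open>bit ^ 'n\<close>.\<close>

text \<open>Linear independence of a family of functions into a field (not of its set of values:
  a repeated function makes the family dependent). It is meant for finite \<open>I\<close>.\<close>

definition lin_indep_family :: "'i set \<Rightarrow> ('i \<Rightarrow> 'a \<Rightarrow> 'b::field) \<Rightarrow> bool" where
  "lin_indep_family I F \<longleftrightarrow>
     (\<forall>c. (\<forall>x. (\<Sum>i\<in>I. c i * F i x) = 0) \<longrightarrow> (\<forall>i\<in>I. c i = 0))"

definition polar_form :: "(bit ^ 'n \<Rightarrow> bit) \<Rightarrow> bit ^ 'n \<Rightarrow> bit ^ 'n \<Rightarrow> bit" where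
  "polar_form f x y = f (x + y) + f x + f y + f 0"

definition represents :: "bit ^ 'n ^ 'n \<Rightarrow> (bit ^ 'n \<Rightarrow> bit ^ 'n \<Rightarrow> bit) \<Rightarrow> bool" where
  "represents B \<beta> \<longleftrightarrow> (\<forall>x y. \<beta> x y = scalar_product x (B *v y))"

definition mat_ker :: "'a::semiring_1 ^ 'n ^ 'm \<Rightarrow> ('a ^ 'n) set" where
  "mat_ker A = {x. A *v x = 0}"

definition outer_prod :: "'a::semiring_1 ^ 'm \<Rightarrow> 'a ^ 'n \<Rightarrow> 'a ^ 'n ^ 'm" where
  "outer_prod u v = (\<chi> a b. u $ a * v $ b)"

end

theory Submission
  imports Defs
begin

text \<open>Over \<open>bit\<close>, a sum with exactly one summand 1 is 1, and 1 + 1 = 0; this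
  settles the first claim. For the kernel, applying the rank-one matrices gives
  \<open>B\<^sub>R *v y\<close> as the sum of \<open>L' i y *s u i + L i y *s v i\<close>. Pairing
  it with an arbitrary \<open>x\<close> turns \<open>B\<^sub>R *v y = 0\<close> into a linear
  relation among the forms \<open>L i\<close>, \<open>L' i\<close>, with the values of the forms at
  \<open>y\<close> as coefficients. Independence makes all these values 0; conversely, if they are
  0, so is the sum. That \<open>B\<^sub>R\<close> is the polar matrix of \<open>R\<close> follows
  from \<open>polar_form_sum\<close>, \<open>polar_form_const_add\<close> and
  \<open>polar_form_product\<close>.\<close>

lemma scalar_product_add_right:
  fixes a x y :: "'a::semiring_1 ^ 'n"
  shows "scalar_product a (x + y) = scalar_product a x + scalar_product a y"
  by (simp add: scalar_product_def distrib_left sum.distrib)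

lemma scalar_product_zero_right:
  fixes a :: "'a::semiring_1 ^ 'n"
  shows "scalar_product a 0 = 0"
  by (simp add: scalar_product_def)

lemma scalar_product_sum_right:
  fixes a :: "'a::semiring_1 ^ 'n"
  shows "scalar_product a (\<Sum>i\<in>I. f i) = (\<Sum>i\<in>I. scalar_product a (f i))"
  by (induction I rule: infinite_finite_induct)
    (simp_all add: scalar_product_add_right scalar_product_zero_right)

lemma sum_matrix_vector_mult:
  fixes A :: "'i \<Rightarrow> 'a::semiring_1 ^ 'n ^ 'm"
  shows "(\<Sum>i\<in>I. A i) *v y = (\<Sum>i\<in>I. A i *v y)"
proof (induction I rule: infinite_finite_induct)
  case (insert i I)
  then show ?case
    by (simp add: matrix_vector_mult_add_rdistrib)
qed (simp_all add: vec_eq_iff matrix_vector_mult_def)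

lemma outer_prod_mult_vec:
  fixes a :: "'a::comm_semiring_1 ^ 'm" and b :: "'a ^ 'n"
  shows "outer_prod a b *v y = scalar_product b y *s a"
  by (simp add: vec_eq_iff matrix_vector_mult_def outer_prod_def scalar_product_def
      sum_distrib_left ac_simps)

text \<open>The arguments are swapped on the right so that, for \<open>a = u i\<close>, the first
  factor reads as \<open>L i x\<close>.\<close>

lemma scalar_product_scale_right:
  fixes a x :: "'a::comm_semiring_1 ^ 'n"
  shows "scalar_product x (c *s a) = scalar_product a x * c"
  by (simp add: scalar_product_def sum_distrib_left ac_simps)

lemma polar_form_sum:
  "polar_form (\<lambda>x. \<Sum>i\<in>I. f i x) x y = (\<Sum>i\<in>I. polar_form (f i) x y)"
  by (simp only: polar_form_def sum.distrib)

text \<open>The constant enters four times and cancels in characteristic 2.\<close>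

lemma polar_form_const_add: "polar_form (\<lambda>x. c + f x) x y = polar_form f x y"
  unfolding polar_form_def
  by (cases c; cases "f (x + y)"; cases "f x"; cases "f y"; cases "f 0") simp_all

text \<open>Expanding the product at \<open>x + y\<close> leaves the two mixed terms; the pure terms
  cancel in pairs. Only four bits are involved, so checking all their values suffices.\<close>

lemma polar_form_product:
  "polar_form (\<lambda>x. scalar_product a x * scalar_product b x) x y
     = scalar_product a x * scalar_product b y + scalar_product b x * scalar_product a y"
  unfolding polar_form_def scalar_product_add_right scalar_product_zero_right
  by (cases "scalar_product a x"; cases "scalar_product b x";
      cases "scalar_product a y"; cases "scalar_product b y") simp_all

lemma sum_eq_one_if_exactly_one:
  fixes q :: "'i \<Rightarrow> bit"
  assumes "finite I" and "\<exists>!i. i \<in> I \<and> q i = 1"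
  shows "(\<Sum>i\<in>I. q i) = 1"
proof -
  obtain k where k: "k \<in> I" "q k = 1" and unique: "\<And>i. i \<in> I \<Longrightarrow> q i = 1 \<Longrightarrow> i = k"
    using assms(2) by blast
  have "(\<Sum>i\<in>I - {k}. q i) = 0"
    \<comment> \<open>A bit other than 1 is 0.\<close>
    by (rule sum.neutral) (metis unique DiffE bit_not_one_iff singletonI)
  then show ?thesis
    using sum.remove[OF assms(1) k(1), of q] k(2) by simp
qed

theorem mainTheorem9:
  fixes r :: nat
    and u v :: "nat \<Rightarrow> bit ^ 'n"
    and L L' Q :: "nat \<Rightarrow> bit ^ 'n \<Rightarrow> bit"
    and R :: "bit ^ 'n \<Rightarrow> bit"
    and B\<^sub>R :: "bit ^ 'n ^ 'n"
  assumes L: "\<And>i x. i \<in> {1..r} \<Longrightarrow> L i x = scalar_product (u i) x"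
    and L': "\<And>i x. i \<in> {1..r} \<Longrightarrow> L' i x = scalar_product (v i) x"
    and Q: "\<And>i x. i \<in> {1..r} \<Longrightarrow> Q i x = L i x * L' i x"
    and R: "\<And>x. R x = 1 + (\<Sum>i = 1..r. L i x * L' i x)"
    and B: "B\<^sub>R = (\<Sum>i = 1..r. outer_prod (u i) (v i) + outer_prod (v i) (u i))"
  shows "(\<forall>x. (\<exists>!i. i \<in> {1..r} \<and> Q i x = 1) \<longrightarrow> 1 + (\<Sum>i = 1..r. L i x * L' i x) = 0)
    \<and> represents B\<^sub>R (polar_form R)
    \<and> (lin_indep_family ({1..r} <+> {1..r}) (case_sum L L') \<longrightarrow>
         mat_ker B\<^sub>R = (\<Inter>i\<in>{1..r}. {x. L i x = 0} \<inter> {x. L' i x = 0})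
         \<and> (\<forall>i\<in>{1..r}. \<forall>x\<in>mat_ker B\<^sub>R. L i x * L' i x = 0))"
proof (intro conjI impI)
  have B_mult: "B\<^sub>R *v y = (\<Sum>i = 1..r. L' i y *s u i + L i y *s v i)" for y
    by (simp add: B L L' sum_matrix_vector_mult matrix_vector_mult_add_rdistrib
        outer_prod_mult_vec)
  have form: "scalar_product x (B\<^sub>R *v y) = (\<Sum>i = 1..r. L i x * L' i y + L' i x * L i y)" for x y
    unfolding B_mult
    by (simp add: scalar_product_sum_right scalar_product_add_right scalar_product_scale_right L L')
  show "\<forall>x. (\<exists>!i. i \<in> {1..r} \<and> Q i x = 1) \<longrightarrow> 1 + (\<Sum>i = 1..r. L i x * L' i x) = 0"
  proof (intro allI impI)
    fix x
    assume "\<exists>!i. i \<in> {1..r} \<and> Q i x = 1"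
    then have "(\<Sum>i = 1..r. Q i x) = 1"
      by (intro sum_eq_one_if_exactly_one) simp_all
    then show "1 + (\<Sum>i = 1..r. L i x * L' i x) = 0"
      by (simp add: Q)
  qed
  show "represents B\<^sub>R (polar_form R)"
    unfolding represents_def
  proof (intro allI)
    fix x y
    \<comment> \<open>An equation between functions is needed, since \<open>polar_form\<close> takes
      the function itself.\<close>
    have "R = (\<lambda>x. 1 + (\<Sum>i = 1..r. scalar_product (u i) x * scalar_product (v i) x))"
      by (simp add: fun_eq_iff R L L')
    then show "polar_form R x y = scalar_product x (B\<^sub>R *v y)"
      by (simp only: polar_form_const_add polar_form_sum polar_form_product form)
        (simp add: L L')
  qed
  assume indep: "lin_indep_family ({1..r} <+> {1..r}) (case_sum L L')"
  show ker: "mat_ker B\<^sub>R = (\<Inter>i\<in>{1..r}. {x. L i x = 0} \<inter> {x. L' i x = 0})"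
  proof (intro equalityI subsetI)
    fix y
    assume "y \<in> mat_ker B\<^sub>R"
    then have zero: "(\<Sum>i = 1..r. L i x * L' i y + L' i x * L i y) = 0" for x
      using form[of x y] by (simp only: mat_ker_def mem_Collect_eq scalar_product_zero_right)
    \<comment> \<open>The roles cross: the coefficient of \<open>L i\<close> is
      \<open>L' i y\<close>, and that of \<open>L' i\<close> is \<open>L i y\<close>. Here
      \<open>y\<close> is fixed and \<open>x\<close> varies.\<close>
    define c where "c = case_sum (\<lambda>i. L' i y) (\<lambda>i. L i y)"
    have "(\<Sum>j\<in>{1..r} <+> {1..r}. c j * case_sum L L' j x) = 0" for x
      using zero[of x]
      by (simp only: sum.Plus finite_atLeastAtMost c_def sum.case sum.distrib comp_def
          mult.commute)
    then have c0: "\<forall>j\<in>{1..r} <+> {1..r}. c j = 0"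
      using indep unfolding lin_indep_family_def by blast
    show "y \<in> (\<Inter>i\<in>{1..r}. {x. L i x = 0} \<inter> {x. L' i x = 0})"
      using c0[rule_format, OF InlI] c0[rule_format, OF InrI] by (simp add: c_def)
  next
    fix y
    assume "y \<in> (\<Inter>i\<in>{1..r}. {x. L i x = 0} \<inter> {x. L' i x = 0})"
    \<comment> \<open>All coefficients in \<open>B_mult\<close> vanish at such a
      \<open>y\<close>.\<close>
    then show "y \<in> mat_ker B\<^sub>R"
      by (simp add: mat_ker_def B_mult)
  qed
  show "\<forall>i\<in>{1..r}. \<forall>x\<in>mat_ker B\<^sub>R. L i x * L' i x = 0"
    unfolding ker by simp
qed

end
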